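(* Let $G$ be a connected graph of order $n\geq 3$. Then $sdiam_3(G)=n-1$ if and only if $G$ is isomorphic to $T_{a,b,c}$ for some integers $0\leq a\leq b\leq c$ with $1\leq b$ and $a+b+c=n-1$, or $G$ is isomorphic to $\triangle_{p,q,r}$ for some integers $0\leq p\leq q\leq r$ with $p+q+r=n-3$.
   Context: All graphs are finite, simple and undirected. For $S\subseteq V(G)$ with $|S|\geq 2$, the Steiner distance $d_G(S)$ is the minimum number of edges of a tree in $G$ whose vertex set contains $S$, and $sdiam_k(G)$ is the maximum of $d_G(S)$ over all $S\subseteq V(G)$ with $|S|=k$. $T_{a,b,c}$ denotes the tree of order $a+b+c+1$ with a vertex $v$ such that $T_{a,b,c}-v$ is the disjoint union of paths $P_a,P_b,P_c$ (with $a,b,c$ vertices respectively), $v$ being adjacent to one endvertex of each nonempty path; $T_{0,b,c}$ is a path. $\triangle_{p,q,r}$ denotes the unicyclic graph of order $p+q+r+3$ consisting of a triangle $K_3$ together with paths $P_p,P_q,P_r$ (with $p,q,r$ vertices) such that removing the triangle's vertices leaves $P_p\cup P_q\cup P_r$, each nonempty path being joined by an edge from one of its endvertices to a distinct vertex of the triangle. *)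

theory Defs
  imports Main
begin

type_synonym 'a sgraph = "'a set \<times> 'a set set"

abbreviation vertices :: "'a sgraph \<Rightarrow> 'a set" where
  "vertices G \<equiv> fst G"

abbreviation edges :: "'a sgraph \<Rightarrow> 'a set set" where
  "edges G \<equiv> snd G"

definition simple_graph :: "'a sgraph \<Rightarrow> bool" where
  "simple_graph G \<longleftrightarrow> finite (vertices G) \<and> (\<forall>e\<in>edges G. e \<subseteq> vertices G \<and> card e = 2)"

definition is_walk :: "'a sgraph \<Rightarrow> 'a list \<Rightarrow> bool" where
  "is_walk G xs \<longleftrightarrow> xs \<noteq> [] \<and> set xs \<subseteq> vertices G \<and> successively (\<lambda>u v. {u, v} \<in> edges G) xs"

definition connected_graph :: "'a sgraph \<Rightarrow> bool" where
  "connected_graph G \<longleftrightarrow> vertices G \<noteq> {} \<and>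
     (\<forall>u\<in>vertices G. \<forall>v\<in>vertices G. \<exists>xs. is_walk G xs \<and> hd xs = u \<and> last xs = v)"

text \<open>A cycle is listed without repeating its first vertex at the end.\<close>

definition is_cycle :: "'a sgraph \<Rightarrow> 'a list \<Rightarrow> bool" where
  "is_cycle G xs \<longleftrightarrow>
     is_walk G xs \<and> distinct xs \<and> 3 \<le> length xs \<and> {last xs, hd xs} \<in> edges G"

definition is_tree :: "'a sgraph \<Rightarrow> bool" where
  "is_tree T \<longleftrightarrow> simple_graph T \<and> connected_graph T \<and> (\<nexists>xs. is_cycle T xs)"

definition is_subgraph :: "'a sgraph \<Rightarrow> 'a sgraph \<Rightarrow> bool" where
  "is_subgraph H G \<longleftrightarrow> simple_graph H \<and> vertices H \<subseteq> vertices G \<and> edges H \<subseteq> edges G"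

text \<open>Meaningful only if some tree in \<open>G\<close> contains \<open>S\<close>, e.g. if \<open>G\<close> is connected and
  \<open>S \<subseteq> vertices G\<close>.\<close>

definition steiner_distance :: "'a sgraph \<Rightarrow> 'a set \<Rightarrow> nat" where
  "steiner_distance G S =
     (LEAST m. \<exists>T. is_subgraph T G \<and> is_tree T \<and> S \<subseteq> vertices T \<and> card (edges T) = m)"

text \<open>Meaningful only for \<open>2 \<le> k \<le> card (vertices G)\<close>; otherwise no admissible \<open>S\<close> exists.\<close>

definition steiner_diameter :: "nat \<Rightarrow> 'a sgraph \<Rightarrow> nat" where
  "steiner_diameter k G = Max (steiner_distance G ` {S. S \<subseteq> vertices G \<and> card S = k})"

definition graph_isomorphic :: "'a sgraph \<Rightarrow> 'b sgraph \<Rightarrow> bool" where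
  "graph_isomorphic G H \<longleftrightarrow>
     (\<exists>f. bij_betw f (vertices G) (vertices H) \<and>
        (\<forall>u\<in>vertices G. \<forall>v\<in>vertices G. {u, v} \<in> edges G \<longleftrightarrow> {f u, f v} \<in> edges H))"

text \<open>The vertex \<open>v\<close> is \<open>(0, 0)\<close>. For \<open>i < 3\<close> the \<open>i\<close>-th path has the vertices
  \<open>(i, 1), (i, 2), \<dots>\<close> in this order; if it is nonempty, \<open>v\<close> is joined to \<open>(i, 1)\<close>.\<close>

definition T_graph :: "nat \<Rightarrow> nat \<Rightarrow> nat \<Rightarrow> (nat \<times> nat) sgraph" where
  "T_graph a b c =
     (insert (0, 0) {(i, j). i < 3 \<and> 1 \<le> j \<and> j \<le> [a, b, c] ! i},
      {{(i, j), (i, Suc j)} | i j. i < 3 \<and> 1 \<le> j \<and> Suc j \<le> [a, b, c] ! i} \<union>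
      {{(0, 0), (i, 1)} | i. i < 3 \<and> 1 \<le> [a, b, c] ! i})"

text \<open>The triangle has the vertices \<open>(0, 0), (1, 0), (2, 0)\<close>. The path joined to \<open>(i, 0)\<close> has
  the vertices \<open>(i, 1), (i, 2), \<dots>\<close> in this order; the case \<open>j = 0\<close> below gives its joining
  edge.\<close>

definition triangle_graph :: "nat \<Rightarrow> nat \<Rightarrow> nat \<Rightarrow> (nat \<times> nat) sgraph" where
  "triangle_graph p q r =
     ({(i, j). i < 3 \<and> j \<le> [p, q, r] ! i},
      {{(i, j), (i, Suc j)} | i j. i < 3 \<and> Suc j \<le> [p, q, r] ! i} \<union>
      {{(0, 0), (1, 0)}, {(1, 0), (2, 0)}, {(0, 0), (2, 0)}})"

end

theory Submission
  imports Defs "HOL-Combinatorics.List_Permutation"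
begin

text \<open>A connected vertex set \<open>W \<supseteq> S\<close> carries a tree with \<open>card W - 1\<close> edges, so \<open>S\<close> has the largest
  possible Steiner distance iff no proper connected vertex set contains \<open>S\<close>. The ends of the
  arms of \<open>T_graph\<close> and \<open>triangle_graph\<close> have this property. Conversely, if \<open>x, y, z\<close> have it,
  then a shortest path \<open>P\<close> from \<open>x\<close> to \<open>y\<close> together with a shortest path \<open>Q\<close> from \<open>P\<close> to \<open>z\<close>
  exhausts the graph. Both paths are induced, and only the first vertex \<open>q\<close> of \<open>Q\<close> off \<open>P\<close> has
  neighbours on \<open>P\<close>. These lie at distance at most 2 along \<open>P\<close>; were two of them at distance
  exactly 2, then rerouting \<open>P\<close> through \<open>q\<close> would save a vertex. So \<open>q\<close> has one neighbour or two
  consecutive neighbours on \<open>P\<close>.\<close>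

subsection \<open>Connectedness by cuts\<close>

text \<open>Connectedness of the subgraph induced by \<open>W\<close>: only edges of
  \<open>E\<close> with both ends in \<open>W\<close> count, so \<open>E\<close> may belong to a
  larger graph. The cut form supplies the next edge when a tree is grown and passes easily to unions
  and preimages.\<close>

definition cut_connected :: "'a set set \<Rightarrow> 'a set \<Rightarrow> bool" where
  "cut_connected E W \<longleftrightarrow> W \<noteq> {} \<and>
     (\<forall>A. A \<subseteq> W \<longrightarrow> A \<noteq> {} \<longrightarrow> A \<noteq> W \<longrightarrow> (\<exists>u\<in>A. \<exists>v\<in>W - A. {u, v} \<in> E))"

lemma cut_connectedD:
  assumes "cut_connected E W" "A \<subseteq> W" "A \<noteq> {}" "A \<noteq> W"
  obtains u v where "u \<in> A" "v \<in> W" "v \<notin> A" "{u, v} \<in> E"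
  using assms unfolding cut_connected_def by blast

lemma cut_connected_mono: "cut_connected E W \<Longrightarrow> E \<subseteq> F \<Longrightarrow> cut_connected F W"
  unfolding cut_connected_def by blast

lemma cut_connected_edge: "{u, v} \<in> E \<Longrightarrow> cut_connected E {u, v}"
  unfolding cut_connected_def
proof (intro conjI allI impI)
  fix A assume E: "{u, v} \<in> E" and A: "A \<subseteq> {u, v}" "A \<noteq> {}" "A \<noteq> {u, v}"
  then have "u \<in> A \<and> v \<notin> A \<or> v \<in> A \<and> u \<notin> A" by blast
  with E show "\<exists>x\<in>A. \<exists>y\<in>{u, v} - A. {x, y} \<in> E"
    by (metis DiffI insert_commute insertI1)
qed simp

section \<open>Walks and the cuts they cross\<close>

lemma successively_crossing:
  assumes "successively P xs" "xs \<noteq> []" "hd xs \<in> A" "last xs \<notin> A"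
  shows "\<exists>u v. u \<in> set xs \<inter> A \<and> v \<in> set xs - A \<and> P u v"
  using assms
proof (induction xs)
  case (Cons x xs)
  show ?case
  proof (cases "xs = []")
    case False
    show ?thesis
    proof (cases "hd xs \<in> A")
      case True
      then show ?thesis using Cons False by (auto simp: successively_Cons)
    next
      case hd: False
      have "P x (hd xs)" "x \<in> A" "hd xs \<in> set xs"
        using Cons.prems False by (auto simp: successively_Cons)
      with hd show ?thesis by auto
    qed
  qed (use Cons in auto)
qed simp

lemma is_walk_append:
  "is_walk G xs \<Longrightarrow> is_walk G ys \<Longrightarrow> {last xs, hd ys} \<in> edges G \<Longrightarrow> is_walk G (xs @ ys)"
  by (auto simp: is_walk_def successively_append_iff)

lemma is_walk_take:
  assumes "is_walk G xs" "0 < n" shows "is_walk G (take n xs)"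
proof -
  have "is_walk G (take n xs @ drop n xs)" using assms by simp
  then show ?thesis
    using assms unfolding is_walk_def successively_append_iff by (auto dest: in_set_takeD)
qed

lemma is_walk_drop:
  assumes "is_walk G xs" "n < length xs" shows "is_walk G (drop n xs)"
proof -
  have "is_walk G (take n xs @ drop n xs)" using assms by simp
  then show ?thesis
    using assms unfolding is_walk_def successively_append_iff by (auto dest: in_set_dropD)
qed

lemma is_walk_nth: "is_walk G xs \<Longrightarrow> Suc i < length xs \<Longrightarrow> {xs ! i, xs ! Suc i} \<in> edges G"
  by (simp add: is_walk_def successively_conv_nth)

text \<open>A walk from inside \<open>A\<close> to outside must cross the cut. Conversely, no edge
  leaves the set of vertices reachable from \<open>u\<close>, so this set cannot be proper.\<close>

lemma connected_graph_iff_cut_connected: "connected_graph G \<longleftrightarrow> cut_connected (edges G) (vertices G)"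
proof
  assume *: "connected_graph G"
  show "cut_connected (edges G) (vertices G)"
    unfolding cut_connected_def
  proof (intro conjI allI impI)
    fix A assume A: "A \<subseteq> vertices G" "A \<noteq> {}" "A \<noteq> vertices G"
    then obtain u v where uv: "u \<in> A" "v \<in> vertices G" "v \<notin> A" by auto
    then obtain xs where "is_walk G xs" "hd xs = u" "last xs = v"
      using * A unfolding connected_graph_def by (metis subsetD)
    then show "\<exists>u\<in>A. \<exists>v\<in>vertices G - A. {u, v} \<in> edges G"
      using successively_crossing[of "\<lambda>u v. {u, v} \<in> edges G" xs A] uv
      by (auto simp: is_walk_def)
  qed (use * in \<open>auto simp: connected_graph_def\<close>)
next
  assume *: "cut_connected (edges G) (vertices G)"
  show "connected_graph G"
    unfolding connected_graph_def
  proof (intro conjI ballI)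
    fix u v assume u: "u \<in> vertices G" and v: "v \<in> vertices G"
    define A where "A = {w. \<exists>xs. is_walk G xs \<and> hd xs = u \<and> last xs = w}"
    have "A \<subseteq> vertices G" by (auto simp: A_def is_walk_def)
    moreover have "is_walk G [u]" using u by (simp add: is_walk_def)
    then have "u \<in> A" unfolding A_def by force
    moreover have "w' \<in> A" if ww: "w \<in> A" "w' \<in> vertices G" "{w, w'} \<in> edges G" for w w'
    proof -
      obtain xs where "is_walk G xs" "hd xs = u" "last xs = w"
        using ww(1) unfolding A_def by blast
      with ww have "is_walk G (xs @ [w'])" "hd (xs @ [w']) = u"
        by (auto simp: is_walk_def successively_append_iff)
      then show ?thesis unfolding A_def by force
    qed
    ultimately have "A = vertices G"
      using * by (metis cut_connectedD empty_iff)
    then show "\<exists>xs. is_walk G xs \<and> hd xs = u \<and> last xs = v"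
      using v by (auto simp: A_def)
  qed (use * in \<open>simp add: cut_connected_def\<close>)
qed

lemma cut_connected_Un:
  assumes W: "cut_connected E W" and X: "cut_connected E X" and "W \<inter> X \<noteq> {}"
  shows "cut_connected E (W \<union> X)"
  unfolding cut_connected_def
proof (intro conjI allI impI)
  fix A assume A: "A \<subseteq> W \<union> X" "A \<noteq> {}" "A \<noteq> W \<union> X"
  \<comment> \<open>If \<open>A\<close> split neither set, it would contain or miss each of them
    entirely; a common vertex forces the same choice for both, making \<open>A\<close> empty or the
    whole union.\<close>
  have "(A \<inter> W \<noteq> {} \<and> A \<inter> W \<noteq> W) \<or> (A \<inter> X \<noteq> {} \<and> A \<inter> X \<noteq> X)"
    using A assms(3) by blast
  then show "\<exists>u\<in>A. \<exists>v\<in>W \<union> X - A. {u, v} \<in> E"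
  proof (elim disjE conjE)
    assume "A \<inter> W \<noteq> {}" "A \<inter> W \<noteq> W"
    then obtain u v where "u \<in> A \<inter> W" "v \<in> W" "v \<notin> A \<inter> W" "{u, v} \<in> E"
      using cut_connectedD[OF W Int_lower2] by metis
    then show ?thesis by blast
  next
    assume "A \<inter> X \<noteq> {}" "A \<inter> X \<noteq> X"
    then obtain u v where "u \<in> A \<inter> X" "v \<in> X" "v \<notin> A \<inter> X" "{u, v} \<in> E"
      using cut_connectedD[OF X Int_lower2] by metis
    then show ?thesis by blast
  qed
qed (use W in \<open>auto simp: cut_connected_def\<close>)

lemma cut_connected_walk:
  assumes "is_walk G xs" shows "cut_connected (edges G) (set xs)"
proof -
  have "successively (\<lambda>u v. {u, v} \<in> edges G) xs" "xs \<noteq> []"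
    using assms by (auto simp: is_walk_def)
  then show ?thesis
  proof (induction xs)
    case (Cons x xs)
    show ?case
    proof (cases "xs = []")
      case False
      then have xs: "cut_connected (edges G) (set xs)" "{x, hd xs} \<in> edges G"
        using Cons by (auto simp: successively_Cons)
      have "cut_connected (edges G) ({x, hd xs} \<union> set xs)"
        using cut_connected_Un[OF cut_connected_edge[OF xs(2)] xs(1)] False by auto
      then show ?thesis using False by (simp add: insert_absorb)
    qed (auto simp: cut_connected_def)
  qed simp
qed

subsection \<open>Spanning trees\<close>

text \<open>Reduction modulo the length treats the closing edge like the others, so both neighbours
  of any position on the cycle are accessible.\<close>

lemma is_cycle_edge:
  assumes "is_cycle G xs" "i < length xs"
  shows "{xs ! i, xs ! (Suc i mod length xs)} \<in> edges G"
proof (cases "Suc i = length xs")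
  case True
  with assms show ?thesis
    by (metis is_cycle_def hd_conv_nth last_conv_nth diff_Suc_1 length_0_conv mod_self nat.simps(3))
next
  case False
  with assms show ?thesis
    by (simp add: is_cycle_def is_walk_nth)
qed

text \<open>A cycle through the new vertex \<open>w\<close> would need two distinct neighbours of
  \<open>w\<close>, but \<open>u\<close> is the only one; a cycle avoiding \<open>w\<close> already
  lies in the old tree.\<close>

lemma is_tree_insert_leaf:
  assumes T: "is_tree (U, F)" and u: "u \<in> U" and w: "w \<notin> U"
  shows "is_tree (insert w U, insert {u, w} F)"
proof -
  let ?T = "(insert w U, insert {u, w} F)"
  have F: "e \<subseteq> U" "card e = 2" if "e \<in> F" for e
    using T that by (auto simp: is_tree_def simple_graph_def)
  have "card {u, w} = 2" using u w by (metis card_2_iff)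
  then have "simple_graph ?T"
    using T u w by (auto simp: is_tree_def simple_graph_def)
  moreover have "cut_connected (insert {u, w} F) {u, w}"
    by (simp add: cut_connected_edge)
  then have "cut_connected (insert {u, w} F) ({u, w} \<union> U)"
    using T u by (intro cut_connected_Un)
      (auto simp: is_tree_def connected_graph_iff_cut_connected intro: cut_connected_mono)
  then have "connected_graph ?T"
    using u by (simp add: connected_graph_iff_cut_connected insert_absorb insert_commute)
  moreover have False if C: "is_cycle ?T xs" for xs
  proof (cases "w \<in> set xs")
    case True
    then obtain i where i: "i < length xs" "xs ! i = w" by (auto simp: in_set_conv_nth)
    define l where "l = length xs"
    have l: "3 \<le> l" "distinct xs" using C by (auto simp: is_cycle_def l_def)
    have nb: "a = u" if "{a, w} \<in> insert {u, w} F" for a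
      using that F(1)[of "{a, w}"] w u by (auto simp: doubleton_eq_iff)
    \<comment> \<open>\<open>j\<close> and \<open>k\<close> are the cyclic predecessor and successor
      of position \<open>i\<close>; they differ because a cycle has length at least 3.\<close>
    define j where "j = (if i = 0 then l - 1 else i - 1)"
    define k where "k = (if Suc i = l then 0 else Suc i)"
    have jk: "j < l" "k < l" "Suc j mod l = i" "Suc i mod l = k" "j \<noteq> k"
      using i l by (auto simp: j_def k_def l_def)
    have "xs ! j = u" "xs ! k = u"
      using nb is_cycle_edge[OF C, of j] is_cycle_edge[OF C, of i] jk i
      by (simp_all add: l_def[symmetric] insert_commute)
    then show False
      using jk l nth_eq_iff_index_eq[of xs j k] by (simp add: l_def)
  next
    case False
    have "is_cycle (U, F) xs"
      unfolding is_cycle_def is_walk_def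
    proof (intro conjI)
      show "successively (\<lambda>u v. {u, v} \<in> edges (U, F)) xs"
        using C False unfolding is_cycle_def is_walk_def
        by (auto simp: successively_conv_nth doubleton_eq_iff)
      have "last xs \<noteq> w" "hd xs \<noteq> w"
        using C False by (auto simp: is_cycle_def is_walk_def)
      then show "{last xs, hd xs} \<in> edges (U, F)"
        using C by (auto simp: is_cycle_def doubleton_eq_iff)
    qed (use C False in \<open>auto simp: is_cycle_def is_walk_def\<close>)
    then show False using T by (auto simp: is_tree_def)
  qed
  ultimately show ?thesis unfolding is_tree_def by blast
qed

text \<open>The tree grows from one vertex: while its vertex set \<open>U\<close> is proper in
  \<open>W\<close>, the cut at \<open>U\<close> yields an edge to a new leaf. Each step adds one
  vertex and one edge, which gives the edge count.\<close>

lemma spanning_tree: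
  assumes "finite W" and W: "cut_connected E W"
  obtains F where "F \<subseteq> E" "is_tree (W, F)" "Suc (card F) = card W"
proof -
  have "\<exists>U F. U \<subseteq> W \<and> card U = Suc k \<and> F \<subseteq> E \<and> is_tree (U, F) \<and> card F = k"
    if "k < card W" for k
    using that
  proof (induction k)
    case 0
    from W obtain v where "v \<in> W" by (auto simp: cut_connected_def)
    moreover have "\<not> is_cycle ({v}, {}) xs" for xs
      by (auto simp: is_cycle_def)
    then have "is_tree ({v}, {})"
      by (auto simp: is_tree_def simple_graph_def connected_graph_iff_cut_connected
          cut_connected_def)
    ultimately show ?case by (intro exI[of _ "{v}"] exI[of _ "{}"]) auto
  next
    case (Suc k)
    then obtain U F where UF: "U \<subseteq> W" "card U = Suc k" "F \<subseteq> E" "is_tree (U, F)" "card F = k"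
      by auto
    with Suc.prems have "U \<noteq> {}" "U \<noteq> W" by auto
    then obtain u w where uw: "u \<in> U" "w \<in> W" "w \<notin> U" "{u, w} \<in> E"
      using cut_connectedD[OF W UF(1)] by metis
    have U: "finite U" using UF(1) \<open>finite W\<close> by (rule finite_subset)
    have F: "\<forall>e\<in>F. e \<subseteq> U"
      using UF by (auto simp: is_tree_def simple_graph_def)
    then have "finite F" using U by (meson Pow_iff finite_Pow_iff finite_subset subsetI)
    moreover have "{u, w} \<notin> F" using F uw by auto
    ultimately show ?case
      using UF uw U is_tree_insert_leaf[OF UF(4) uw(1,3)]
      by (intro exI[of _ "insert w U"] exI[of _ "insert {u, w} F"]) auto
  qed
  note trees = this
  have "0 < card W" using assms by (auto simp: cut_connected_def card_gt_0_iff)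
  then have "card W - 1 < card W" by simp
  from trees[OF this] obtain U F where *: "U \<subseteq> W" "card U = Suc (card W - 1)" "F \<subseteq> E" "is_tree (U, F)"
    "card F = card W - 1"
    by blast
  with \<open>0 < card W\<close> have "U = W" "Suc (card F) = card W"
    using \<open>finite W\<close> by (simp_all add: card_subset_eq)
  then show thesis using that *(3,4) by blast
qed

subsection \<open>Extremal Steiner distance\<close>

text \<open>Extremality expressed by vertex sets alone; in this form it can be checked by cuts and
  transported along isomorphisms.\<close>

definition steiner_spanning :: "'a sgraph \<Rightarrow> 'a set \<Rightarrow> bool" where
  "steiner_spanning G S \<longleftrightarrow>
     (\<forall>W. S \<subseteq> W \<longrightarrow> W \<subseteq> vertices G \<longrightarrow> cut_connected (edges G) W \<longrightarrow> W = vertices G)"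

text \<open>A spanning tree of \<open>W\<close> has \<open>card W - 1\<close> edges and competes in
  the minimum.\<close>

lemma steiner_distance_less_card:
  assumes "simple_graph G" "S \<subseteq> W" "W \<subseteq> vertices G" "cut_connected (edges G) W"
  shows "steiner_distance G S < card W"
proof -
  have "finite W" using assms by (auto simp: simple_graph_def intro: finite_subset)
  then obtain F where F: "F \<subseteq> edges G" "is_tree (W, F)" "Suc (card F) = card W"
    using spanning_tree assms(4) by metis
  then have "steiner_distance G S \<le> card F"
    unfolding steiner_distance_def
    using assms by (intro Least_le exI[of _ "(W, F)"]) (auto simp: is_subgraph_def is_tree_def)
  with F show ?thesis by simp
qed

lemma steiner_distance_attained:
  assumes "simple_graph G" "connected_graph G" "S \<subseteq> vertices G"
  obtains W where "S \<subseteq> W" "W \<subseteq> vertices G" "cut_connected (edges G) W"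
    "card W = Suc (steiner_distance G S)"
proof -
  let ?P = "\<lambda>m. \<exists>T. is_subgraph T G \<and> is_tree T \<and> S \<subseteq> vertices T \<and> card (edges T) = m"
  have "finite (vertices G)" "cut_connected (edges G) (vertices G)"
    using assms by (auto simp: connected_graph_iff_cut_connected simple_graph_def)
  then obtain F where "F \<subseteq> edges G" "is_tree (vertices G, F)"
    using spanning_tree by metis
  \<comment> \<open>A spanning tree of \<open>G\<close> is a candidate, so the \<open>LEAST\<close>
    is attained.\<close>
  then have "?P (card F)"
    using assms by (intro exI[of _ "(vertices G, F)"]) (auto simp: is_subgraph_def is_tree_def)
  then have "?P (steiner_distance G S)"
    unfolding steiner_distance_def by (rule LeastI)
  then obtain T where T: "is_subgraph T G" "is_tree T" "S \<subseteq> vertices T"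
    "card (edges T) = steiner_distance G S" by blast
  have fin: "finite (vertices T)" "finite (edges T)"
    using T(2) finite_subset[of "edges T" "Pow (vertices T)"]
    by (auto simp: is_tree_def simple_graph_def)
  have conn: "cut_connected (edges T) (vertices T)"
    using T(2) by (simp add: is_tree_def connected_graph_iff_cut_connected)
  \<comment> \<open>Comparison with a spanning tree of \<open>T\<close> itself bounds the number of
    vertices of \<open>T\<close> by its number of edges plus one; the reverse bound is
    \<open>steiner_distance_less_card\<close>.\<close>
  then obtain F where "F \<subseteq> edges T" "Suc (card F) = card (vertices T)"
    using spanning_tree fin(1) by metis
  then have "card (vertices T) \<le> Suc (steiner_distance G S)"
    using card_mono[OF fin(2), of F] T(4) by simp
  moreover have "vertices T \<subseteq> vertices G" "cut_connected (edges G) (vertices T)"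
    using T(1) cut_connected_mono[OF conn] by (auto simp: is_subgraph_def)
  ultimately show thesis
    using that[of "vertices T"] steiner_distance_less_card[OF assms(1) T(3)] T(3) by simp
qed

text \<open>If the distance is maximal, a connected superset of \<open>S\<close> has too many
  vertices to be proper. Conversely, the vertex set of an optimal tree must be everything.\<close>

lemma steiner_distance_eq_iff:
  assumes "simple_graph G" "connected_graph G" "S \<subseteq> vertices G"
  shows "steiner_distance G S = card (vertices G) - 1 \<longleftrightarrow> steiner_spanning G S"
proof -
  have fin: "finite (vertices G)" and pos: "vertices G \<noteq> {}"
    using assms by (auto simp: simple_graph_def connected_graph_def)
  then have pos: "0 < card (vertices G)" by (simp add: card_gt_0_iff)
  obtain W where W: "S \<subseteq> W" "W \<subseteq> vertices G" "cut_connected (edges G) W"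
    "card W = Suc (steiner_distance G S)"
    using steiner_distance_attained[OF assms] .
  show ?thesis
  proof
    assume *: "steiner_distance G S = card (vertices G) - 1"
    show "steiner_spanning G S"
      unfolding steiner_spanning_def
    proof (intro allI impI)
      fix X assume "S \<subseteq> X" "X \<subseteq> vertices G" "cut_connected (edges G) X"
      then show "X = vertices G"
        using steiner_distance_less_card[OF assms(1), of S X] * pos card_seteq[OF fin, of X]
        by linarith
    qed
  next
    assume "steiner_spanning G S"
    then have "W = vertices G" using W by (auto simp: steiner_spanning_def)
    then show "steiner_distance G S = card (vertices G) - 1" using W by simp
  qed
qed

text \<open>All distances are at most \<open>card (vertices G) - 1\<close>, so the maximum equals
  this bound iff some set attains it. The bound on \<open>k\<close> makes the family of sets
  nonempty.\<close>

lemma steiner_diameter_eq_iff: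
  assumes "simple_graph G" "connected_graph G" "k \<le> card (vertices G)"
  shows "steiner_diameter k G = card (vertices G) - 1 \<longleftrightarrow>
    (\<exists>S. S \<subseteq> vertices G \<and> card S = k \<and> steiner_spanning G S)"
proof -
  let ?A = "{S. S \<subseteq> vertices G \<and> card S = k}"
  have fin: "finite (vertices G)" using assms by (simp add: simple_graph_def)
  then have "finite ?A" by simp
  moreover have "?A \<noteq> {}" using obtain_subset_with_card_n[OF assms(3)] by blast
  moreover have "steiner_distance G S \<le> card (vertices G) - 1" if "S \<in> ?A" for S
    using steiner_distance_less_card[OF assms(1), of S "vertices G"] assms(2) that
    by (auto simp: connected_graph_iff_cut_connected)
  ultimately have "steiner_diameter k G = card (vertices G) - 1 \<longleftrightarrow>
      card (vertices G) - 1 \<in> steiner_distance G ` ?A"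
    unfolding steiner_diameter_def by (subst Max_eq_iff) auto
  also have "\<dots> \<longleftrightarrow> (\<exists>S\<in>?A. steiner_distance G S = card (vertices G) - 1)"
    by (auto simp: image_iff eq_commute)
  finally show ?thesis
    using steiner_distance_eq_iff[OF assms(1,2)] by auto
qed

subsection \<open>Isomorphisms\<close>

lemma graph_isomorphic_sym:
  assumes "graph_isomorphic G H" shows "graph_isomorphic H G"
proof -
  obtain f where f: "bij_betw f (vertices G) (vertices H)"
    "\<And>u v. u \<in> vertices G \<Longrightarrow> v \<in> vertices G \<Longrightarrow> {u, v} \<in> edges G \<longleftrightarrow> {f u, f v} \<in> edges H"
    using assms by (auto simp: graph_isomorphic_def)
  let ?g = "inv_into (vertices G) f"
  have "bij_betw ?g (vertices H) (vertices G)" using f(1) by (rule bij_betw_inv_into)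
  moreover have "{u, v} \<in> edges H \<longleftrightarrow> {?g u, ?g v} \<in> edges G"
    if "u \<in> vertices H" "v \<in> vertices H" for u v
    using f(2)[of "?g u" "?g v"] that f(1) calculation
    by (simp add: bij_betw_inv_into_right bij_betw_apply)
  ultimately show ?thesis unfolding graph_isomorphic_def by blast
qed

lemma graph_isomorphic_trans:
  assumes "graph_isomorphic G H" "graph_isomorphic H K" shows "graph_isomorphic G K"
proof -
  obtain f g where f: "bij_betw f (vertices G) (vertices H)"
    "\<And>u v. u \<in> vertices G \<Longrightarrow> v \<in> vertices G \<Longrightarrow> {u, v} \<in> edges G \<longleftrightarrow> {f u, f v} \<in> edges H"
    and g: "bij_betw g (vertices H) (vertices K)"
    "\<And>u v. u \<in> vertices H \<Longrightarrow> v \<in> vertices H \<Longrightarrow> {u, v} \<in> edges H \<longleftrightarrow> {g u, g v} \<in> edges K"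
    using assms by (auto simp: graph_isomorphic_def)
  have "bij_betw (g \<circ> f) (vertices G) (vertices K)" using f(1) g(1) by (rule bij_betw_trans)
  moreover have "{u, v} \<in> edges G \<longleftrightarrow> {(g \<circ> f) u, (g \<circ> f) v} \<in> edges K"
    if "u \<in> vertices G" "v \<in> vertices G" for u v
    using f g that by (simp add: bij_betw_apply)
  ultimately show ?thesis unfolding graph_isomorphic_def by blast
qed

text \<open>Carries the arm ends of a model graph over to \<open>G\<close>. A connected set
  \<open>W\<close> containing the image of \<open>S\<close> pulls back to a connected set
  \<open>X\<close> containing \<open>S\<close>, which must be everything.\<close>

lemma steiner_spanning_isomorphic:
  assumes "graph_isomorphic H G" "steiner_spanning H S" "S \<subseteq> vertices H"
  shows "\<exists>S'. S' \<subseteq> vertices G \<and> card S' = card S \<and> steiner_spanning G S'"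
proof -
  obtain f where f: "bij_betw f (vertices H) (vertices G)"
    "\<And>u v. u \<in> vertices H \<Longrightarrow> v \<in> vertices H \<Longrightarrow> {u, v} \<in> edges H \<longleftrightarrow> {f u, f v} \<in> edges G"
    using assms by (auto simp: graph_isomorphic_def)
  have inj: "inj_on f (vertices H)" and img: "f ` vertices H = vertices G"
    using f(1) by (auto simp: bij_betw_def)
  have "steiner_spanning G (f ` S)"
    unfolding steiner_spanning_def
  proof (intro allI impI)
    fix W assume W: "f ` S \<subseteq> W" "W \<subseteq> vertices G" "cut_connected (edges G) W"
    define X where "X = {x \<in> vertices H. f x \<in> W}"
    have fX: "f ` X = W" using W(2) img by (auto simp: X_def)
    have "cut_connected (edges H) X"
      unfolding cut_connected_def
    proof (intro conjI allI impI)
      show "X \<noteq> {}" using W(3) fX by (auto simp: cut_connected_def)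
      fix A assume A: "A \<subseteq> X" "A \<noteq> {}" "A \<noteq> X"
      have XH: "X \<subseteq> vertices H" by (auto simp: X_def)
      have "f ` A \<noteq> W" "f ` A \<subseteq> W" "f ` A \<noteq> {}"
        using A fX XH inj by (auto simp: inj_on_image_eq_iff[OF inj])
      then obtain u v where "u \<in> f ` A" "v \<in> W" "v \<notin> f ` A" "{u, v} \<in> edges G"
        using cut_connectedD[OF W(3)] by metis
      then obtain a b where "a \<in> A" "b \<in> X - A" "{f a, f b} \<in> edges G"
        using fX by auto
      then show "\<exists>u\<in>A. \<exists>v\<in>X - A. {u, v} \<in> edges H"
        using f(2) A XH by blast
    qed
    moreover have "S \<subseteq> X" using W(1) assms(3) by (auto simp: X_def)
    ultimately have "X = vertices H"
      using assms(2) unfolding steiner_spanning_def X_def by blast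
    then show "W = vertices G" using fX img by simp
  qed
  moreover have "card (f ` S) = card S"
    using inj assms(3) by (meson card_image inj_on_subset)
  moreover have "f ` S \<subseteq> vertices G" using assms(3) img by auto
  ultimately show ?thesis by blast
qed

subsection \<open>The graphs \<open>T_graph\<close> and \<open>triangle_graph\<close>\<close>

lemma less_3_cases: "i < (3::nat) \<longleftrightarrow> i = 0 \<or> i = 1 \<or> i = 2"
  by auto

lemma T_graph_vertices: "(i, j) \<in> vertices (T_graph a b c) \<longleftrightarrow>
    i < 3 \<and> j \<le> [a, b, c] ! i \<and> (j = 0 \<longrightarrow> i = 0)"
  by (auto simp: T_graph_def)

text \<open>Among the vertices, second coordinate 0 occurs only at the centre \<open>(0, 0)\<close>,
  so the last two alternatives are exactly the edges at the centre.\<close>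

lemma T_graph_edges:
  assumes "(i, j) \<in> vertices (T_graph a b c)" "(i', j') \<in> vertices (T_graph a b c)"
  shows "{(i, j), (i', j')} \<in> edges (T_graph a b c) \<longleftrightarrow>
    i = i' \<and> (j = Suc j' \<or> j' = Suc j) \<or> j = 0 \<and> j' = 1 \<or> j = 1 \<and> j' = 0"
proof
  show "{(i, j), (i', j')} \<in> edges (T_graph a b c) \<Longrightarrow>
    i = i' \<and> (j = Suc j' \<or> j' = Suc j) \<or> j = 0 \<and> j' = 1 \<or> j = 1 \<and> j' = 0"
    by (auto simp: T_graph_def doubleton_eq_iff)
next
  have hub: "{(0, 0), (k, 1)} \<in> edges (T_graph a b c)" if "(k, 1) \<in> vertices (T_graph a b c)" for k
    using that by (auto simp: T_graph_def)
  have arm: "{(k, l), (k, Suc l)} \<in> edges (T_graph a b c)"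
    if "(k, l) \<in> vertices (T_graph a b c)" "(k, Suc l) \<in> vertices (T_graph a b c)" for k l
  proof (cases "l = 0")
    case True
    with that hub[of k] show ?thesis by (simp add: T_graph_vertices)
  next
    case False
    then have "1 \<le> l" by simp
    with that show ?thesis unfolding T_graph_vertices by (simp add: T_graph_def) blast
  qed
  assume "i = i' \<and> (j = Suc j' \<or> j' = Suc j) \<or> j = 0 \<and> j' = 1 \<or> j = 1 \<and> j' = 0"
  then show "{(i, j), (i', j')} \<in> edges (T_graph a b c)"
    using arm[of i j] arm[of i j'] hub[of i] hub[of i'] assms
    by (auto simp: T_graph_vertices insert_commute)
qed

lemma triangle_graph_vertices:
  "(i, j) \<in> vertices (triangle_graph p q r) \<longleftrightarrow> i < 3 \<and> j \<le> [p, q, r] ! i"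
  by (simp add: triangle_graph_def)

lemma triangle_graph_edges:
  assumes "(i, j) \<in> vertices (triangle_graph p q r)" "(i', j') \<in> vertices (triangle_graph p q r)"
  shows "{(i, j), (i', j')} \<in> edges (triangle_graph p q r) \<longleftrightarrow>
    i = i' \<and> (j = Suc j' \<or> j' = Suc j) \<or> i \<noteq> i' \<and> j = 0 \<and> j' = 0"
proof
  show "{(i, j), (i', j')} \<in> edges (triangle_graph p q r) \<Longrightarrow>
    i = i' \<and> (j = Suc j' \<or> j' = Suc j) \<or> i \<noteq> i' \<and> j = 0 \<and> j' = 0"
    by (auto simp: triangle_graph_def doubleton_eq_iff)
next
  have base: "{(k, 0), (l, 0)} \<in> edges (triangle_graph p q r)" if "k < 3" "l < 3" "k \<noteq> l" for k l
    using that by (auto simp: triangle_graph_def less_3_cases insert_commute)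
  have arm: "{(k, l), (k, Suc l)} \<in> edges (triangle_graph p q r)"
    if "(k, Suc l) \<in> vertices (triangle_graph p q r)" for k l
    using that unfolding triangle_graph_vertices by (simp add: triangle_graph_def) blast
  assume "i = i' \<and> (j = Suc j' \<or> j' = Suc j) \<or> i \<noteq> i' \<and> j = 0 \<and> j' = 0"
  then show "{(i, j), (i', j')} \<in> edges (triangle_graph p q r)"
    using arm[of i j] arm[of i j'] base[of i i'] assms
    by (auto simp: triangle_graph_vertices insert_commute)
qed

text \<open>If \<open>(i, j)\<close> were missing from \<open>W\<close>, the vertices of arm
  \<open>i\<close> beyond position \<open>j\<close> could be left only through it. Those in
  \<open>W\<close> include the end \<open>(i, e)\<close> but not \<open>w\<close>, so
  \<open>W\<close> would be disconnected.\<close>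

lemma steiner_spanning_arms:
  assumes ends: "(i, e) \<in> W" "j \<le> e" "w \<in> W" "fst w \<noteq> i"
    and W: "cut_connected E W"
    and step: "\<And>j' w. (i, j') \<in> W \<Longrightarrow> j < j' \<Longrightarrow> w \<in> W \<Longrightarrow> {(i, j'), w} \<in> E \<Longrightarrow>
      w = (i, Suc j') \<or> w = (i, j' - 1) \<or> w = (i, j)"
  shows "(i, j) \<in> W"
proof (rule ccontr)
  assume n: "(i, j) \<notin> W"
  let ?A = "{(i, j') | j'. (i, j') \<in> W \<and> j < j'}"
  have "j < e" using n ends by (cases "j = e") auto
  then have "(i, e) \<in> ?A" using ends by simp
  moreover have "w \<notin> ?A" using ends by auto
  ultimately have A: "?A \<subseteq> W" "?A \<noteq> {}" "?A \<noteq> W" using ends by blast+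
  obtain u v where uv: "u \<in> ?A" "v \<in> W" "v \<notin> ?A" "{u, v} \<in> E"
    using cut_connectedD[OF W A] .
  then obtain j' where j': "u = (i, j')" "(i, j') \<in> W" "j < j'" by auto
  then have "v = (i, Suc j') \<or> v = (i, j' - 1) \<or> v = (i, j)" using step uv by blast
  moreover have "v \<noteq> (i, j)" using uv n by auto
  moreover have "(i, j' - 1) \<in> W \<Longrightarrow> j' - 1 \<noteq> j" using n by auto
  ultimately show False using uv j' by (auto simp: less_diff_conv)
qed

text \<open>\<open>(0, 0)\<close> counts as position 0 of arm 0, so the arm argument covers the
  centre too. The end of another arm serves as the vertex off arm \<open>i\<close>.\<close>

lemma T_graph_steiner_spanning:
  "steiner_spanning (T_graph a b c) {(0, a), (1, b), (2, c)}" if "1 \<le> b" "1 \<le> c"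
  unfolding steiner_spanning_def
proof (intro allI impI subset_antisym)
  fix W assume S: "{(0, a), (1, b), (2, c)} \<subseteq> W" and W: "W \<subseteq> vertices (T_graph a b c)"
    "cut_connected (edges (T_graph a b c)) W"
  show "vertices (T_graph a b c) \<subseteq> W"
  proof clarify
    fix i j assume ij: "(i, j) \<in> vertices (T_graph a b c)"
    show "(i, j) \<in> W"
    proof (rule steiner_spanning_arms[OF _ _ _ _ W(2)])
      show "(i, [a, b, c] ! i) \<in> W" "j \<le> [a, b, c] ! i"
        using S ij by (auto simp: T_graph_vertices less_3_cases)
      show "(if i = 0 then (1, b) else (0, a)) \<in> W"
        "fst (if i = 0 then (1, b) else (0, a)) \<noteq> i"
        using S by auto
    next
      fix j' w assume "(i, j') \<in> W" "j < j'" "w \<in> W" "{(i, j'), w} \<in> edges (T_graph a b c)"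
      then show "w = (i, Suc j') \<or> w = (i, j' - 1) \<or> w = (i, j)"
        using T_graph_edges[of i j' a b c "fst w" "snd w"] W(1) ij
        by (cases w) (auto simp: T_graph_vertices subset_iff)
    qed
  qed
qed

lemma triangle_graph_steiner_spanning:
  "steiner_spanning (triangle_graph p q r) {(0, p), (1, q), (2, r)}"
  unfolding steiner_spanning_def
proof (intro allI impI subset_antisym)
  fix W assume S: "{(0, p), (1, q), (2, r)} \<subseteq> W" and W: "W \<subseteq> vertices (triangle_graph p q r)"
    "cut_connected (edges (triangle_graph p q r)) W"
  show "vertices (triangle_graph p q r) \<subseteq> W"
  proof clarify
    fix i j assume ij: "(i, j) \<in> vertices (triangle_graph p q r)"
    show "(i, j) \<in> W"
    proof (rule steiner_spanning_arms[OF _ _ _ _ W(2)])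
      show "(i, [p, q, r] ! i) \<in> W" "j \<le> [p, q, r] ! i"
        using S ij by (auto simp: triangle_graph_vertices less_3_cases)
      show "(if i = 0 then (1, q) else (0, p)) \<in> W"
        "fst (if i = 0 then (1, q) else (0, p)) \<noteq> i"
        using S by auto
    next
      fix j' w assume "(i, j') \<in> W" "j < j'" "w \<in> W"
        "{(i, j'), w} \<in> edges (triangle_graph p q r)"
      then show "w = (i, Suc j') \<or> w = (i, j' - 1) \<or> w = (i, j)"
        using triangle_graph_edges[of i j' p q r "fst w" "snd w"] W(1) ij
        by (cases w) (auto simp: subset_iff)
    qed
  qed
qed

section \<open>Reordering the arms by length\<close>

lemma sorted_triple:
  fixes a b c :: nat
  obtains a' b' c' \<sigma> where "a' \<le> b'" "b' \<le> c'" "a' + b' + c' = a + b + c"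
    "bij_betw \<sigma> {..<3} {..<3}" "\<forall>i<3. [a, b, c] ! i = [a', b', c'] ! \<sigma> i"
proof -
  let ?l = "sort [a, b, c]"
  have "\<exists>x y z. l = [x, y, z]" if "length l = 3" for l :: "nat list"
    using that by (auto simp: numeral_3_eq_3 length_Suc_conv)
  then obtain a' b' c' where l: "?l = [a', b', c']"
    by (metis length_Cons length_sort list.size(3) numeral_3_eq_3)
  \<comment> \<open>Sorting preserves the multiset of entries, and lists with equal multisets are
    related by a bijection of positions.\<close>
  have m: "mset [a, b, c] = mset [a', b', c']" by (metis l mset_sort)
  obtain \<sigma> where \<sigma>: "bij_betw \<sigma> {..<length [a, b, c]} {..<length [a', b', c']}"
    "\<forall>i<length [a, b, c]. [a, b, c] ! i = [a', b', c'] ! \<sigma> i"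
    using permutation_Ex_bij[OF m] by blast
  have len: "length [x, y, z] = 3" for x y z :: nat by simp
  show thesis
  proof (rule that)
    have "sorted [a', b', c']" unfolding l[symmetric] by (rule sorted_sort)
    then show "a' \<le> b'" "b' \<le> c'" by simp_all
    have "sum_mset (mset [a', b', c']) = sum_mset (mset [a, b, c])" by (simp only: m)
    then show "a' + b' + c' = a + b + c" by (simp only: sum_mset_sum_list) simp
    show "bij_betw \<sigma> {..<3} {..<3}" using \<sigma>(1) unfolding len .
    show "\<forall>i<3. [a, b, c] ! i = [a', b', c'] ! \<sigma> i" using \<sigma>(2) unfolding len .
  qed
qed

lemma T_graph_permute:
  assumes \<sigma>: "bij_betw \<sigma> {..<3} {..<3}" "\<And>i. i < 3 \<Longrightarrow> [a, b, c] ! i = [a', b', c'] ! \<sigma> i"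
  shows "graph_isomorphic (T_graph a b c) (T_graph a' b' c')"
proof -
  \<comment> \<open>The centre is the only vertex with \<open>j = 0\<close>; it must stay
    \<open>(0, 0)\<close> even when \<sigma> moves arm 0.\<close>
  let ?f = "\<lambda>(i, j). (if j = 0 then i else \<sigma> i, j :: nat)"
  let ?T = "T_graph a b c" and ?T' = "T_graph a' b' c'"
  have lt: "\<sigma> i < 3" if "i < 3" for i using \<sigma>(1) that by (auto dest: bij_betw_apply)
  have inj: "\<sigma> i = \<sigma> i' \<longleftrightarrow> i = i'" if "i < 3" "i' < 3" for i i'
    using \<sigma>(1) that by (auto simp: bij_betw_def inj_on_def)
  have f: "?f x \<in> vertices ?T'" if "x \<in> vertices ?T" for x
    using that by (cases x) (auto simp: T_graph_vertices lt \<sigma>(2)[symmetric])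
  have "bij_betw ?f (vertices ?T) (vertices ?T')"
    unfolding bij_betw_def
  proof (intro conjI subset_antisym image_subsetI)
    show "inj_on ?f (vertices ?T)"
      by (auto simp: inj_on_def T_graph_vertices inj split: if_splits)
    show "vertices ?T' \<subseteq> ?f ` vertices ?T"
    proof clarify
      fix k j assume k: "(k, j) \<in> vertices ?T'"
      then have "k \<in> \<sigma> ` {..<3}" using \<sigma>(1) by (auto simp: bij_betw_def T_graph_vertices)
      then obtain i where i: "i < 3" "k = \<sigma> i" by auto
      show "(k, j) \<in> ?f ` vertices ?T"
        using i k \<sigma>(2)[of i]
        by (intro image_eqI[of _ _ "(if j = 0 then 0 else i, j)"]) (auto simp: T_graph_vertices)
    qed
  qed (use f in auto)
  moreover have "{u, v} \<in> edges ?T \<longleftrightarrow> {?f u, ?f v} \<in> edges ?T'"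
    if "u \<in> vertices ?T" "v \<in> vertices ?T" for u v
  proof -
    obtain i j i' j' where uv: "u = (i, j)" "v = (i', j')" by (cases u, cases v)
    have *: "i < 3" "i' < 3" "j = 0 \<Longrightarrow> i = 0" "j' = 0 \<Longrightarrow> i' = 0"
      using that by (auto simp: uv T_graph_vertices)
    show ?thesis
      using T_graph_edges[of i j a b c i' j'] that f[OF that(1)] f[OF that(2)] inj[OF *(1,2)] *
      by (auto simp: uv T_graph_edges)
  qed
  ultimately show ?thesis unfolding graph_isomorphic_def by blast
qed

lemma triangle_graph_permute:
  assumes \<sigma>: "bij_betw \<sigma> {..<3} {..<3}" "\<And>i. i < 3 \<Longrightarrow> [a, b, c] ! i = [a', b', c'] ! \<sigma> i"
  shows "graph_isomorphic (triangle_graph a b c) (triangle_graph a' b' c')"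
proof -
  \<comment> \<open>Unlike the centre of \<open>T_graph\<close>, the triangle vertices
    \<open>(i, 0)\<close> move with their arms; any permutation of them preserves the
    triangle.\<close>
  let ?f = "\<lambda>(i, j). (\<sigma> i, j :: nat)"
  let ?T = "triangle_graph a b c" and ?T' = "triangle_graph a' b' c'"
  have lt: "\<sigma> i < 3" if "i < 3" for i using \<sigma>(1) that by (auto dest: bij_betw_apply)
  have inj: "\<sigma> i = \<sigma> i' \<longleftrightarrow> i = i'" if "i < 3" "i' < 3" for i i'
    using \<sigma>(1) that by (auto simp: bij_betw_def inj_on_def)
  have f: "?f x \<in> vertices ?T'" if "x \<in> vertices ?T" for x
    using that by (cases x) (auto simp: triangle_graph_vertices lt \<sigma>(2)[symmetric])
  have "bij_betw ?f (vertices ?T) (vertices ?T')"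
    unfolding bij_betw_def
  proof (intro conjI subset_antisym image_subsetI)
    show "inj_on ?f (vertices ?T)"
      by (auto simp: inj_on_def triangle_graph_vertices inj)
    show "vertices ?T' \<subseteq> ?f ` vertices ?T"
    proof clarify
      fix k j assume k: "(k, j) \<in> vertices ?T'"
      then have "k \<in> \<sigma> ` {..<3}" using \<sigma>(1) by (auto simp: bij_betw_def triangle_graph_vertices)
      then obtain i where i: "i < 3" "k = \<sigma> i" by auto
      show "(k, j) \<in> ?f ` vertices ?T"
        using i k \<sigma>(2)[of i]
        by (intro image_eqI[of _ _ "(i, j)"]) (auto simp: triangle_graph_vertices)
    qed
  qed (use f in auto)
  moreover have "{u, v} \<in> edges ?T \<longleftrightarrow> {?f u, ?f v} \<in> edges ?T'"
    if "u \<in> vertices ?T" "v \<in> vertices ?T" for u v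
  proof -
    obtain i j i' j' where uv: "u = (i, j)" "v = (i', j')" by (cases u, cases v)
    have *: "i < 3" "i' < 3"
      using that by (auto simp: uv triangle_graph_vertices)
    show ?thesis
      using triangle_graph_edges[of i j a b c i' j'] that f[OF that(1)] f[OF that(2)] inj[OF *]
      by (auto simp: uv triangle_graph_edges)
  qed
  ultimately show ?thesis unfolding graph_isomorphic_def by blast
qed

subsection \<open>Geodesics\<close>

text \<open>The competitors are all walks of \<open>G\<close> with the same ends, and
  \<open>length\<close> counts vertices. Minimality makes such a walk an induced path, as the next
  lemmas show.\<close>

definition geodesic :: "'a sgraph \<Rightarrow> 'a list \<Rightarrow> bool" where
  "geodesic G xs \<longleftrightarrow> is_walk G xs \<and>
     (\<forall>ys. is_walk G ys \<and> hd ys = hd xs \<and> last ys = last xs \<longrightarrow> length xs \<le> length ys)"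

text \<open>Replacing the part of \<open>xs\<close> from position \<open>i\<close> to
  \<open>j\<close> by \<open>ys\<close> gives a competing walk. The replaced part has
  \<open>j - i + 1\<close> vertices; the inequality is arranged to avoid subtraction.\<close>

lemma geodesic_segment:
  assumes xs: "geodesic G xs" and ij: "i \<le> j" "j < length xs"
    and ys: "is_walk G ys" "hd ys = xs ! i" "last ys = xs ! j"
  shows "Suc j \<le> i + length ys"
proof -
  have W: "is_walk G xs" using xs by (simp add: geodesic_def)
  have ne: "ys \<noteq> []" using ys by (simp add: is_walk_def)
  have 1: "is_walk G (take i xs @ ys)" "hd (take i xs @ ys) = hd xs"
  proof -
    show "is_walk G (take i xs @ ys)"
    proof (cases i)
      case (Suc k)
      have "last (take i xs) = xs ! k" using Suc ij by (simp add: take_Suc_conv_app_nth)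
      then show ?thesis
        using is_walk_append[OF is_walk_take[OF W, of i] ys(1)] is_walk_nth[OF W, of k] Suc ij ys
        by simp
    qed (use ys in simp)
    show "hd (take i xs @ ys) = hd xs"
      using ij ys by (cases i; cases xs) auto
  qed
  let ?zs = "(take i xs @ ys) @ drop (Suc j) xs"
  have "is_walk G ?zs" "last ?zs = last xs"
  proof -
    show "is_walk G ?zs"
    proof (cases "Suc j < length xs")
      case True
      then show ?thesis
        using is_walk_append[OF 1(1) is_walk_drop[OF W, of "Suc j"]] is_walk_nth[OF W, of j] ys ne
        by (simp add: hd_drop_conv_nth)
    qed (use 1 in simp)
    show "last ?zs = last xs"
    proof (cases "Suc j < length xs")
      case False
      then have "Suc j = length xs" using ij by simp
      then show ?thesis using ne ys
        by (metis append_Nil2 diff_Suc_1 drop_eq_Nil last_appendR last_conv_nth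
              le_refl length_0_conv nat.simps(3))
    qed simp
  qed
  moreover have "hd ?zs = hd xs" using 1(2) ne by (metis append_is_Nil_conv hd_append2)
  ultimately have "length xs \<le> length ?zs" using xs by (auto simp: geodesic_def)
  then show ?thesis using ij by simp
qed

text \<open>Between two occurrences of one vertex, the one-vertex walk would be a shorter
  replacement.\<close>

lemma geodesic_distinct:
  assumes "geodesic G xs" shows "distinct xs"
proof -
  have "xs ! i \<noteq> xs ! j" if "i < j" "j < length xs" for i j
  proof
    assume eq: "xs ! i = xs ! j"
    have "is_walk G [xs ! j]"
      using assms that by (auto simp: is_walk_def geodesic_def)
    then show False using geodesic_segment[OF assms, of i j "[xs ! j]"] that eq by simp
  qed
  then show ?thesis by (metis distinct_conv_nth linorder_neqE_nat)
qed

text \<open>An edge between positions \<open>i < j\<close> is a replacement with two vertices, so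
  \<open>j\<close> is at most \<open>Suc i\<close>.\<close>

lemma geodesic_edge_iff:
  assumes G: "simple_graph G" "geodesic G xs" and ij: "i < length xs" "j < length xs"
  shows "{xs ! i, xs ! j} \<in> edges G \<longleftrightarrow> i = Suc j \<or> j = Suc i"
proof
  have W: "is_walk G xs" using G by (simp add: geodesic_def)
  have *: "j = Suc i" if "{xs ! i, xs ! j} \<in> edges G" "i < j" "j < length xs" for i j
  proof -
    have "is_walk G [xs ! i, xs ! j]" using W that by (auto simp: is_walk_def)
    then show ?thesis using geodesic_segment[OF G(2), of i j "[xs ! i, xs ! j]"] that by simp
  qed
  have "i \<noteq> j" if "{xs ! i, xs ! j} \<in> edges G"
    using that G(1) by (auto simp: simple_graph_def)
  then show "{xs ! i, xs ! j} \<in> edges G \<Longrightarrow> i = Suc j \<or> j = Suc i"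
    using *[of i j] *[of j i] ij by (auto simp: insert_commute neq_iff)
  show "i = Suc j \<or> j = Suc i \<Longrightarrow> {xs ! i, xs ! j} \<in> edges G"
    using is_walk_nth[OF W, of i] is_walk_nth[OF W, of j] ij by (auto simp: insert_commute)
qed

subsection \<open>Two induced paths\<close>

text \<open>Two disjoint induced paths covering \<open>G\<close>. The edges between them are left
  open; the isomorphism lemmas fix them by an assumption \<open>pq\<close>. The second path may be
  empty, \<open>m = 0\<close>.\<close>

locale two_paths =
  fixes G :: "'a sgraph" and p q :: "nat \<Rightarrow> 'a" and k m :: nat
  assumes p_inj: "i < k \<Longrightarrow> j < k \<Longrightarrow> p i = p j \<longleftrightarrow> i = j"
    and q_inj: "i < m \<Longrightarrow> j < m \<Longrightarrow> q i = q j \<longleftrightarrow> i = j"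
    and p_neq_q: "i < k \<Longrightarrow> j < m \<Longrightarrow> p i \<noteq> q j"
    and vertices_eq: "vertices G = p ` {..<k} \<union> q ` {..<m}"
    and p_edge: "i < k \<Longrightarrow> j < k \<Longrightarrow> {p i, p j} \<in> edges G \<longleftrightarrow> i = Suc j \<or> j = Suc i"
    and q_edge: "i < m \<Longrightarrow> j < m \<Longrightarrow> {q i, q j} \<in> edges G \<longleftrightarrow> i = Suc j \<or> j = Suc i"
begin

lemma card_vertices: "card (vertices G) = k + m"
proof -
  have "inj_on p {..<k}" "inj_on q {..<m}" using p_inj q_inj by (auto simp: inj_on_def)
  moreover have "p ` {..<k} \<inter> q ` {..<m} = {}" using p_neq_q by auto
  ultimately show ?thesis by (simp add: vertices_eq card_Un_disjoint card_image)
qed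

lemma isomorphic_T_graph:
  assumes s: "s < k"
    and pq: "\<And>i j. i < k \<Longrightarrow> j < m \<Longrightarrow> {p i, q j} \<in> edges G \<longleftrightarrow> j = 0 \<and> i = s"
  shows "graph_isomorphic G (T_graph s (k - 1 - s) m)"
proof -
  define T where "T = T_graph s (k - 1 - s) m"
  \<comment> \<open>The centre goes to \<open>p s\<close>; arm 0 runs down from it along
    \<open>p\<close>, arm 1 runs up, and arm 2 is \<open>q\<close>. The shift \<open>j - 1\<close>
    arises because arm positions start at 1 but \<open>q\<close> starts at 0.\<close>
  let ?f = "\<lambda>(i :: nat, j). if i = 0 then p (s - j) else if i = 1 then p (s + j) else q (j - 1)"
  have V: "x \<in> vertices T \<longleftrightarrow> (\<exists>j\<le>s. x = (0, j)) \<or> (\<exists>j. 0 < j \<and> j < k - s \<and> x = (1, j)) \<or>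
      (\<exists>j. 0 < j \<and> j \<le> m \<and> x = (2, j))" for x
    using s by (cases x) (auto simp: T_def T_graph_vertices less_3_cases)
  have q_neq_p: "q j \<noteq> p i" if "i < k" "j < m" for i j
    using p_neq_q[OF that] by simp
  \<comment> \<open>Subtraction on naturals is injective only while it does not truncate; the
    positions on arm 0 stay in this range.\<close>
  have sub: "s - i = s - j \<longleftrightarrow> i = j" if "i \<le> s" "j \<le> s" for i j
    using that by linarith
  have qp: "{q j, p i} \<in> edges G \<longleftrightarrow> j = 0 \<and> i = s" if "i < k" "j < m" for i j
    using pq[OF that] by (simp add: insert_commute)
  have "bij_betw ?f (vertices T) (vertices G)"
    unfolding bij_betw_def
  proof (intro conjI subset_antisym image_subsetI)
    show "inj_on ?f (vertices T)"
      using s by (auto simp: inj_on_def V p_inj q_inj p_neq_q q_neq_p sub)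
    show "?f x \<in> vertices G" if "x \<in> vertices T" for x
      using that s by (auto simp: V vertices_eq)
    show "vertices G \<subseteq> ?f ` vertices T"
      unfolding vertices_eq
    proof (intro Un_least image_subsetI)
      show "p i \<in> ?f ` vertices T" if "i \<in> {..<k}" for i
        using that s
        by (intro image_eqI[of _ _ "if i \<le> s then (0, s - i) else (1, i - s)"])
          (auto simp: V)
      show "q j \<in> ?f ` vertices T" if "j \<in> {..<m}" for j
        using that by (intro image_eqI[of _ _ "(2, Suc j)"]) (auto simp: V)
    qed
  qed
  moreover have "{u, v} \<in> edges T \<longleftrightarrow> {?f u, ?f v} \<in> edges G"
    if uv: "u \<in> vertices T" "v \<in> vertices T" for u v
  proof -
    obtain i j i' j' where ij: "u = (i, j)" "v = (i', j')" by (cases u, cases v)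
    show ?thesis
      using uv s unfolding ij T_graph_edges[OF uv[unfolded ij T_def], folded T_def]
      unfolding V by (elim disjE exE conjE) (auto simp: p_edge q_edge pq qp)
  qed
  ultimately show ?thesis
    unfolding T_def[symmetric]
    by (intro graph_isomorphic_sym[of T]) (auto simp: graph_isomorphic_def)
qed

lemma isomorphic_triangle_graph:
  assumes s: "Suc s < k" and m: "0 < m"
    and pq: "\<And>i j. i < k \<Longrightarrow> j < m \<Longrightarrow> {p i, q j} \<in> edges G \<longleftrightarrow> j = 0 \<and> (i = s \<or> i = Suc s)"
  shows "graph_isomorphic G (triangle_graph s (k - 2 - s) (m - 1))"
proof -
  define T where "T = triangle_graph s (k - 2 - s) (m - 1)"
  \<comment> \<open>The triangle is \<open>p s\<close>, \<open>p (Suc s)\<close>,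
    \<open>q 0\<close>. Each is position 0 of its own arm, so \<open>q\<close> needs no shift
    here.\<close>
  let ?f = "\<lambda>(i :: nat, j). if i = 0 then p (s - j) else if i = 1 then p (Suc s + j) else q j"
  have V: "x \<in> vertices T \<longleftrightarrow> (\<exists>j\<le>s. x = (0, j)) \<or> (\<exists>j. j < k - Suc s \<and> x = (1, j)) \<or>
      (\<exists>j<m. x = (2, j))" for x
    using s m by (cases x) (auto simp: T_def triangle_graph_vertices less_3_cases)
  have q_neq_p: "q j \<noteq> p i" if "i < k" "j < m" for i j
    using p_neq_q[OF that] by simp
  have sub: "s - i = s - j \<longleftrightarrow> i = j" if "i \<le> s" "j \<le> s" for i j
    using that by linarith
  have qp: "{q j, p i} \<in> edges G \<longleftrightarrow> j = 0 \<and> (i = s \<or> i = Suc s)" if "i < k" "j < m" for i j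
    using pq[OF that] by (simp add: insert_commute)
  have "bij_betw ?f (vertices T) (vertices G)"
    unfolding bij_betw_def
  proof (intro conjI subset_antisym image_subsetI)
    show "inj_on ?f (vertices T)"
      using s by (auto simp: inj_on_def V p_inj q_inj p_neq_q q_neq_p sub)
    show "?f x \<in> vertices G" if "x \<in> vertices T" for x
      using that s by (auto simp: V vertices_eq)
    show "vertices G \<subseteq> ?f ` vertices T"
      unfolding vertices_eq
    proof (intro Un_least image_subsetI)
      show "p i \<in> ?f ` vertices T" if "i \<in> {..<k}" for i
        using that s
        by (intro image_eqI[of _ _ "if i \<le> s then (0, s - i) else (1, i - Suc s)"])
          (auto simp: V)
      show "q j \<in> ?f ` vertices T" if "j \<in> {..<m}" for j
        using that by (intro image_eqI[of _ _ "(2, j)"]) (auto simp: V)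
    qed
  qed
  moreover have "{u, v} \<in> edges T \<longleftrightarrow> {?f u, ?f v} \<in> edges G"
    if uv: "u \<in> vertices T" "v \<in> vertices T" for u v
  proof -
    obtain i j i' j' where ij: "u = (i, j)" "v = (i', j')" by (cases u, cases v)
    show ?thesis
      using uv s unfolding ij triangle_graph_edges[OF uv[unfolded ij T_def], folded T_def]
      unfolding V by (elim disjE exE conjE) (auto simp: p_edge q_edge pq qp)
  qed
  ultimately show ?thesis
    unfolding T_def[symmetric]
    by (intro graph_isomorphic_sym[of T]) (auto simp: graph_isomorphic_def)
qed

end

text \<open>Prepares the hypotheses of the two isomorphism lemmas: the second path is attached at
  one vertex of the first, or at two consecutive ones. An empty second path falls under the first
  case.\<close>

lemma steiner_spanning_two_paths:
  assumes G: "simple_graph G" "connected_graph G" and V: "{x, y, z} \<subseteq> vertices G"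
    and "x \<noteq> y" and sp: "steiner_spanning G {x, y, z}"
  obtains p q k m s where "two_paths G p q k m" "2 \<le> k" "s < k"
    "\<And>i j. i < k \<Longrightarrow> j < m \<Longrightarrow> {p i, q j} \<in> edges G \<longleftrightarrow> j = 0 \<and> i = s"
  | p q k m s where "two_paths G p q k m" "0 < m" "Suc s < k"
    "\<And>i j. i < k \<Longrightarrow> j < m \<Longrightarrow> {p i, q j} \<in> edges G \<longleftrightarrow> j = 0 \<and> (i = s \<or> i = Suc s)"
proof -
  have spD: "W = vertices G"
    if "cut_connected (edges G) W" "x \<in> W" "y \<in> W" "z \<in> W" "W \<subseteq> vertices G" for W
    using sp that unfolding steiner_spanning_def by simp
  let ?P = "\<lambda>xs. is_walk G xs \<and> hd xs = x \<and> last xs = y"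
  have "\<exists>xs. ?P xs" using G(2) V by (simp add: connected_graph_def)
  then obtain xs where xs: "?P xs" and xs_min: "\<And>zs. ?P zs \<Longrightarrow> length xs \<le> length zs"
    using ex_has_least_nat[of ?P _ length] by blast
  \<comment> \<open>Minimality ranges over all starting vertices on \<open>xs\<close>. So
    \<open>ys\<close> is geodesic and also meets \<open>xs\<close> only in its first vertex.\<close>
  let ?Q = "\<lambda>ys. is_walk G ys \<and> hd ys \<in> set xs \<and> last ys = z"
  have xs_ne: "xs \<noteq> []" and xs_V: "set xs \<subseteq> vertices G" using xs by (auto simp: is_walk_def)
  then have "hd xs \<in> vertices G" by auto
  then have "\<exists>ys. is_walk G ys \<and> hd ys = hd xs \<and> last ys = z"
    using G(2) V by (simp add: connected_graph_def)
  then have "\<exists>ys. ?Q ys" using hd_in_set[OF xs_ne] by metis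
  then obtain ys where ys: "?Q ys" and ys_min: "\<And>zs. ?Q zs \<Longrightarrow> length ys \<le> length zs"
    using ex_has_least_nat[of ?Q _ length] by blast
  have geo: "geodesic G xs" "geodesic G ys"
    using xs ys xs_min ys_min by (auto simp: geodesic_def)
  have ys_ne: "ys \<noteq> []" and ys_V: "set ys \<subseteq> vertices G" using ys by (auto simp: is_walk_def)
  have cov: "set xs \<union> set ys = vertices G"
  proof -
    \<comment> \<open>The two paths share \<open>hd ys\<close>, so their union is connected; it
      contains the triple, and extremality makes it everything.\<close>
    have "hd ys \<in> set xs \<inter> set ys" using ys ys_ne by simp
    then have "cut_connected (edges G) (set xs \<union> set ys)"
      using xs ys by (intro cut_connected_Un cut_connected_walk) auto
    moreover have "{x, y, z} \<subseteq> set xs \<union> set ys" using xs ys xs_ne ys_ne by auto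
    ultimately show ?thesis using sp xs_V ys_V by (auto simp: steiner_spanning_def)
  qed
  define p where "p i = xs ! i" for i
  \<comment> \<open>The first vertex of \<open>ys\<close> lies on \<open>xs\<close>, so the second
    path starts at index 1 and has one vertex less than \<open>ys\<close>.\<close>
  define q where "q j = ys ! Suc j" for j
  define k where "k = length xs"
  define m where "m = length ys - 1"
  have len: "length ys = Suc m" using ys_ne by (simp add: m_def)
  have hd_ys: "hd ys = ys ! 0" using ys_ne by (simp add: hd_conv_nth)
  have p_in: "p i \<in> set xs" if "i < k" for i using that by (simp add: p_def k_def)
  \<comment> \<open>Otherwise the rest of \<open>ys\<close> from that vertex on would be a shorter
    walk from \<open>xs\<close> to \<open>z\<close>.\<close>
  have q_notin: "q j \<notin> set xs" if "j < m" for j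
    using that ys_min[of "drop (Suc j) ys"] ys is_walk_drop[of G ys "Suc j"]
    by (auto simp: q_def len hd_drop_conv_nth)
  have set_xs: "set xs = p ` {..<k}"
    by (auto simp: p_def k_def in_set_conv_nth)
  have "set (tl ys) = (!) (tl ys) ` {..<m}"
    by (auto simp: m_def in_set_conv_nth)
  also have "\<dots> = q ` {..<m}"
    by (intro image_cong) (auto simp: q_def m_def nth_tl)
  finally have set_tl: "set (tl ys) = q ` {..<m}" .
  have set_ys: "set ys = insert (hd ys) (set (tl ys))"
    using ys_ne by (cases ys) auto
  have tp: "two_paths G p q k m"
  proof
    show "p i = p j \<longleftrightarrow> i = j" if "i < k" "j < k" for i j
      using that geodesic_distinct[OF geo(1)] by (simp add: p_def k_def nth_eq_iff_index_eq)
    show "q i = q j \<longleftrightarrow> i = j" if "i < m" "j < m" for i j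
      using that geodesic_distinct[OF geo(2)] by (simp add: q_def len nth_eq_iff_index_eq)
    show "p i \<noteq> q j" if "i < k" "j < m" for i j
      using that p_in q_notin by metis
    show "vertices G = p ` {..<k} \<union> q ` {..<m}"
    proof -
      have "set xs \<union> set ys = set xs \<union> set (tl ys)" unfolding set_ys using ys by auto
      then show ?thesis using cov unfolding set_xs set_tl by simp
    qed
    show "{p i, p j} \<in> edges G \<longleftrightarrow> i = Suc j \<or> j = Suc i" if "i < k" "j < k" for i j
      using geodesic_edge_iff[OF G(1) geo(1)] that by (simp add: p_def k_def)
    show "{q i, q j} \<in> edges G \<longleftrightarrow> i = Suc j \<or> j = Suc i" if "i < m" "j < m" for i j
      using geodesic_edge_iff[OF G(1) geo(2), of "Suc i" "Suc j"] that by (simp add: q_def len)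
  qed
  have "k \<noteq> 1"
    using xs \<open>x \<noteq> y\<close> by (auto simp: k_def length_Suc_conv)
  then have k: "2 \<le> k" using xs_ne by (cases k) (auto simp: k_def)
  \<comment> \<open>Entering \<open>ys\<close> at \<open>q j\<close> directly from
    \<open>p i\<close> gives a walk with \<open>Suc m - j\<close> vertices, which must not beat the
    \<open>Suc m\<close> vertices of \<open>ys\<close>.\<close>
  have first: "j = 0" if "i < k" "j < m" "{p i, q j} \<in> edges G" for i j
  proof -
    have "is_walk G ([p i] @ drop (Suc j) ys)"
      using that ys is_walk_drop[of G ys "Suc j"] p_in[of i] xs_V
      by (intro is_walk_append) (auto simp: is_walk_def q_def len hd_drop_conv_nth)
    then have "length ys \<le> length ([p i] @ drop (Suc j) ys)"
      using that p_in ys by (intro ys_min) (auto simp: len)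
    then show ?thesis using that by (simp add: len)
  qed
  let ?N = "\<lambda>i. i < k \<and> {p i, q 0} \<in> edges G"
  \<comment> \<open>The detour \<open>p i\<close>, \<open>q 0\<close>, \<open>p j\<close> has three
    vertices, so minimality of \<open>xs\<close> bounds \<open>j - i\<close> by 2; extremality of
    the triple rules out 2.\<close>
  have near: "j = Suc i" if ij: "?N i" "?N j" "i < j" and m: "0 < m" for i j
  proof -
    have e: "{p i, q 0} \<in> edges G" "{q 0, p j} \<in> edges G"
      using ij by (simp_all add: insert_commute)
    have q0: "q 0 \<in> vertices G" "q 0 \<notin> set xs"
      using m ys_V q_notin by (auto simp: q_def len)
    have "is_walk G [p i, q 0, p j]"
      using ij e q0 p_in xs_V by (auto simp: is_walk_def)
    then have "j \<le> i + 2"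
      using geodesic_segment[OF geo(1), of i j "[p i, q 0, p j]"] ij by (simp add: k_def p_def)
    moreover have "j \<noteq> i + 2"
    proof
      assume j: "j = i + 2"
      \<comment> \<open>Rerouting the geodesic through \<open>q 0\<close> makes the vertex \<open>p (Suc i)\<close> superfluous.\<close>
      let ?zs = "(take (Suc i) xs @ [q 0]) @ drop j xs"
      have lt: "j < length xs" using ij by (simp add: k_def)
      have "last (take (Suc i) xs) = p i"
        using lt j by (simp add: take_Suc_conv_app_nth p_def)
      then have "is_walk G (take (Suc i) xs @ [q 0])"
        using xs e q0 is_walk_take[of G xs "Suc i"]
        by (intro is_walk_append) (auto simp: is_walk_def)
      then have "is_walk G ?zs"
        using is_walk_append[OF _ is_walk_drop[of G xs j]] xs e lt
        by (auto simp: hd_drop_conv_nth p_def simp del: append_assoc)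
      \<comment> \<open>\<open>tl ys\<close> starts at \<open>q 0\<close>, so it links the rerouted
        walk to \<open>z\<close> while avoiding \<open>xs\<close>.\<close>
      moreover have "is_walk G (tl ys)"
        using is_walk_drop[of G ys 1] ys m len by (simp add: drop_Suc)
      moreover have "q 0 \<in> set ?zs \<inter> set (tl ys)"
        using m set_tl by auto
      ultimately have "cut_connected (edges G) (set ?zs \<union> set (tl ys))"
        by (intro cut_connected_Un cut_connected_walk) auto
      moreover have "x \<in> set ?zs"
        using xs xs_ne by (cases xs) auto
      moreover have "y \<in> set ?zs"
      proof -
        have "last (drop j xs) = y" "drop j xs \<noteq> []" using lt xs by auto
        then show ?thesis using last_in_set[of "drop j xs"] by simp
      qed
      moreover have "z \<in> set (tl ys)"
      proof -
        have "tl ys \<noteq> []" using m len by (cases ys) auto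
        then show ?thesis using ys last_in_set last_tl by metis
      qed
      moreover have "set ?zs \<union> set (tl ys) \<subseteq> vertices G"
        using q0 xs_V ys_V set_ys set_take_subset[of "Suc i" xs] set_drop_subset[of j xs] by auto
      ultimately have "set ?zs \<union> set (tl ys) = vertices G"
        using spD[of "set ?zs \<union> set (tl ys)"] by (simp only: Un_iff simp_thms)
      moreover have "p (Suc i) \<notin> set ?zs"
      proof -
        have "xs = (take (Suc i) xs @ [p (Suc i)]) @ drop j xs"
          using lt j by (metis Suc_lessD add_2_eq_Suc' append_take_drop_id p_def
              take_Suc_conv_app_nth)
        then have "distinct ((take (Suc i) xs @ [p (Suc i)]) @ drop j xs)"
          using geodesic_distinct[OF geo(1)] by metis
        moreover have "p (Suc i) \<noteq> q 0" using q0 p_in[of "Suc i"] lt j by (auto simp: k_def)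
        ultimately show ?thesis by (simp add: eq_commute)
      qed
      moreover have "p (Suc i) \<in> set xs" "p (Suc i) \<notin> set (tl ys)"
        using p_in[of "Suc i"] lt j set_tl q_notin by (auto simp: k_def)
      ultimately show False using xs_V by blast
    qed
    ultimately show ?thesis using ij(3) by linarith
  qed
  show thesis
  proof (cases "m = 0")
    case True
    \<comment> \<open>Without vertices \<open>q j\<close> the edge condition is vacuous, and any
      \<open>s < k\<close> serves.\<close>
    then show ?thesis using that(1)[OF tp k, of 0] k by auto
  next
    case False
    obtain i where "i < k" "hd ys = p i" using ys set_xs by auto
    then have "?N i"
      using is_walk_nth[of G ys 0] ys False len hd_ys by (simp add: q_def)
    \<comment> \<open>With the least neighbour index as \<open>s\<close>, \<open>near\<close> leaves
      only \<open>s\<close> and \<open>Suc s\<close>.\<close>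
    define s where "s = (LEAST i. ?N i)"
    have s: "?N s" unfolding s_def using \<open>?N i\<close> by (rule LeastI)
    have le: "s \<le> j" if "?N j" for j unfolding s_def using that by (rule Least_le)
    have N: "j = s \<or> j = Suc s" if "?N j" for j
      using near[OF s that] le[OF that] False by linarith
    show ?thesis
    proof (cases "?N (Suc s)")
      case True
      show ?thesis
      proof (rule that(2)[OF tp])
        show "{p i, q j} \<in> edges G \<longleftrightarrow> j = 0 \<and> (i = s \<or> i = Suc s)" if "i < k" "j < m" for i j
          using first[OF that] N[of i] s True that by auto
      qed (use False True in auto)
    next
      case nb: False
      show ?thesis
      proof (rule that(1)[OF tp k])
        show "{p i, q j} \<in> edges G \<longleftrightarrow> j = 0 \<and> i = s" if "i < k" "j < m" for i j
          using first[OF that] N[of i] s nb that by auto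
      qed (use s in auto)
    qed
  qed
qed

subsection \<open>Characterisation\<close>

theorem theorem4:
  fixes G :: "'a sgraph" and n :: nat
  assumes "simple_graph G" and "connected_graph G"
    and "card (vertices G) = n" and "n \<ge> 3"
  shows "steiner_diameter 3 G = n - 1 \<longleftrightarrow>
    (\<exists>a b c. a \<le> b \<and> b \<le> c \<and> 1 \<le> b \<and> a + b + c = n - 1 \<and> graph_isomorphic G (T_graph a b c)) \<or>
    (\<exists>p q r. p \<le> q \<and> q \<le> r \<and> p + q + r = n - 3 \<and> graph_isomorphic G (triangle_graph p q r))"
    (is "_ \<longleftrightarrow> ?T \<or> ?D")
proof -
  have "steiner_diameter 3 G = n - 1 \<longleftrightarrow>
      (\<exists>S. S \<subseteq> vertices G \<and> card S = 3 \<and> steiner_spanning G S)"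
    using steiner_diameter_eq_iff[OF assms(1,2), of 3] assms(3,4) by simp
  also have "\<dots> \<longleftrightarrow> ?T \<or> ?D"
  proof
    assume "\<exists>S. S \<subseteq> vertices G \<and> card S = 3 \<and> steiner_spanning G S"
    then obtain x y z where xyz: "{x, y, z} \<subseteq> vertices G" "x \<noteq> y" "steiner_spanning G {x, y, z}"
      by (auto simp: card_3_iff)
    show "?T \<or> ?D"
      using assms(1,2) xyz
    proof (cases rule: steiner_spanning_two_paths)
      case (1 p q k m s)
      have n: "k + m = n" using two_paths.card_vertices[OF 1(1)] assms(3) by simp
      \<comment> \<open>If \<open>m = 0\<close>, then \<open>G\<close> is a path and \<open>s\<close> may be an end of it, so another centre is chosen.\<close>
      define t where "t = (if m = 0 then 1 else s)"
      have t: "t < k" "m = 0 \<Longrightarrow> 0 < t \<and> 0 < k - 1 - t"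
        using 1(2,3) n assms(4) by (auto simp: t_def)
      have iso: "graph_isomorphic G (T_graph t (k - 1 - t) m)"
        using two_paths.isomorphic_T_graph[OF 1(1) t(1)] 1(4) by (simp add: t_def)
      obtain a b c \<sigma> where abc: "a \<le> b" "b \<le> c" "a + b + c = t + (k - 1 - t) + m"
        "bij_betw \<sigma> {..<3} {..<3}" "\<forall>i<3. [t, k - 1 - t, m] ! i = [a, b, c] ! \<sigma> i"
        by (rule sorted_triple[of t "k - 1 - t" m])
      have "graph_isomorphic G (T_graph a b c)"
        using graph_isomorphic_trans[OF iso T_graph_permute[OF abc(4) abc(5)[rule_format]]] .
      moreover have "a + b + c = n - 1" using abc(3) n t(1) by linarith
      \<comment> \<open>If \<open>b = 0\<close>, a single arm holds all vertices but the centre.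
        This is impossible, since at least two of \<open>t\<close>, \<open>k - 1 - t\<close>,
        \<open>m\<close> are positive.\<close>
      moreover have "1 \<le> b"
      proof (rule ccontr)
        assume "\<not> 1 \<le> b"
        then have c: "c = t + (k - 1 - t) + m" using abc(1,3) by simp
        have "2 \<in> \<sigma> ` {..<3}" using abc(4) by (simp add: bij_betw_def)
        then obtain i where i: "i < 3" "\<sigma> i = 2" by auto
        have "[t, k - 1 - t, m] ! i = c" using abc(5)[rule_format, OF i(1)] i(2) by simp
        then show False
          using i(1) c t 1(2) by (cases "m = 0") (auto simp: less_3_cases)
      qed
      ultimately show ?thesis using abc(1,2) by blast
    next
      case (2 p q k m s)
      have n: "k + m = n" using two_paths.card_vertices[OF 2(1)] assms(3) by simp
      have iso: "graph_isomorphic G (triangle_graph s (k - 2 - s) (m - 1))"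
        using two_paths.isomorphic_triangle_graph[OF 2(1,3,2,4)] .
      obtain a b c \<sigma> where abc: "a \<le> b" "b \<le> c" "a + b + c = s + (k - 2 - s) + (m - 1)"
        "bij_betw \<sigma> {..<3} {..<3}" "\<forall>i<3. [s, k - 2 - s, m - 1] ! i = [a, b, c] ! \<sigma> i"
        by (rule sorted_triple[of s "k - 2 - s" "m - 1"])
      have "graph_isomorphic G (triangle_graph a b c)"
        using graph_isomorphic_trans[OF iso triangle_graph_permute[OF abc(4) abc(5)[rule_format]]] .
      moreover have "a + b + c = n - 3" using abc(3) n 2(2,3) by linarith
      ultimately show ?thesis using abc(1,2) by blast
    qed
  next
    assume "?T \<or> ?D"
    then show "\<exists>S. S \<subseteq> vertices G \<and> card S = 3 \<and> steiner_spanning G S"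
    proof (elim disjE exE conjE)
      fix a b c assume abc: "a \<le> b" "b \<le> c" "1 \<le> b" "graph_isomorphic G (T_graph a b c)"
      \<comment> \<open>The first coordinates keep the three vertices distinct, even when
        \<open>a = 0\<close> and the first one is the centre.\<close>
      let ?S = "{(0, a), (1, b), (2, c)} :: (nat \<times> nat) set"
      have "steiner_spanning (T_graph a b c) ?S" using abc by (intro T_graph_steiner_spanning) auto
      moreover have "?S \<subseteq> vertices (T_graph a b c)" using abc by (auto simp: T_graph_vertices)
      moreover have "card ?S = 3" by simp
      ultimately show ?thesis
        using steiner_spanning_isomorphic[OF graph_isomorphic_sym[OF abc(4)]] by metis
    next
      fix p q r assume iso: "graph_isomorphic G (triangle_graph p q r)"
      \<comment> \<open>For an empty arm, the triangle vertex itself takes the role of the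
        end.\<close>
      let ?S = "{(0, p), (1, q), (2, r)} :: (nat \<times> nat) set"
      have "?S \<subseteq> vertices (triangle_graph p q r)" by (auto simp: triangle_graph_vertices)
      moreover have "card ?S = 3" by simp
      ultimately show ?thesis
        using steiner_spanning_isomorphic[OF graph_isomorphic_sym[OF iso]
            triangle_graph_steiner_spanning] by metis
    qed
  qed
  finally show ?thesis .
qed

end
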